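(* Let $k \geq \ell \geq 2$ be integers with $\ell\le n$ and $k\le\frac{q^n-1}{q-1}$. Then $\Gamma_{n}^{(k,\ell)}={\rm Ind}^{{\rm pro}}_q(n,k,\ell)$.
   Context: Let $\mathcal{K}$ be a field with a discrete valuation $\nu$, valuation ring $\mathcal{O}$, maximal ideal $\mathfrak{m}$, and finite residue field $\mathcal{O}/\mathfrak{m}\cong\mathbb{F}_q$. Put $|\lambda|=q^{-\nu(\lambda)}$ and $\|\mathbf{v}\|=\max_{i}|v_i|$ on $\mathcal{K}^n$. Nonzero vectors $\mathbf{u}_1,\dots,\mathbf{u}_m$ are orthogonal if $\|\sum_i\lambda_i\mathbf{u}_i\|=\max_i\|\lambda_i\mathbf{u}_i\|$ for all $\lambda_i\in\mathcal{K}$; a finite set is orthogonal if its elements are; a set is weakly orthogonal if any two distinct elements are orthogonal. A weakly orthogonal set $S\subseteq\mathcal{K}^n\setminus\{\mathbf 0\}$ is $(k,\ell)$-strongly orthogonal if every $E\subseteq S$ of size $k$ contains an orthogonal subset of size $\ell$; $\Gamma_n^{(k,\ell)}$ is the maximum size of such a set. For $1\le\ell\le k\le\frac{q^n-1}{q-1}$ with $\ell\le n$, a set $S\subseteq\mathbb{P}^{n-1}(\mathbb{F}_q)$ is $(k,\ell)$-pro-independent if every $X\subseteq S$ of size $k$ contains $\ell$ linearly independent points (i.e. the span of (lifts of) $X$ in $\mathbb{F}_q^n$ has dimension $\ge\ell$); $\operatorname{Ind}^{\rm pro}_q(n,k,\ell)$ is the maximum size of such $S$. *)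

theory Defs
  imports
    "HOL-Analysis.Cartesian_Space"
    "HOL-Algebra.QuotRing"
    "HOL-Algebra.Algebraic_Closure_Type"
    "HOL-Library.Extended_Nat"
begin

section \<open>Discretely valued fields\<close>

text \<open>The convention \<open>\<nu>(0) = \<infinity>\<close> is encoded by treating \<open>0\<close> separately everywhere;
  the integer \<open>\<nu> 0\<close> is unconstrained and never used. Surjectivity onto the integers is
  the usual normalization of a discrete valuation.\<close>

locale discrete_valuation =
  fixes \<nu> :: "'k::field \<Rightarrow> int"
  assumes val_mult: "x \<noteq> 0 \<Longrightarrow> y \<noteq> 0 \<Longrightarrow> \<nu> (x * y) = \<nu> x + \<nu> y"
    and val_add: "x \<noteq> 0 \<Longrightarrow> y \<noteq> 0 \<Longrightarrow> x + y \<noteq> 0 \<Longrightarrow> \<nu> (x + y) \<ge> min (\<nu> x) (\<nu> y)"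
    and val_surj: "\<nu> ` (UNIV - {0}) = UNIV"

definition valuation_ring :: "('k::field \<Rightarrow> int) \<Rightarrow> 'k ring" where
  "valuation_ring \<nu> = ring_of_type_algebra\<lparr>carrier := {x. x = 0 \<or> \<nu> x \<ge> 0}\<rparr>"

definition max_ideal :: "('k::field \<Rightarrow> int) \<Rightarrow> 'k set" where
  "max_ideal \<nu> = {x. x = 0 \<or> \<nu> x > 0}"

definition residue_field :: "('k::field \<Rightarrow> int) \<Rightarrow> 'k set ring" where
  "residue_field \<nu> = valuation_ring \<nu> Quot max_ideal \<nu>"

definition vabs :: "('k::field \<Rightarrow> int) \<Rightarrow> 'k \<Rightarrow> real" where
  "vabs \<nu> x = (if x = 0 then 0 else real (card (carrier (residue_field \<nu>))) powi (- \<nu> x))"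

definition vnorm :: "('k::field \<Rightarrow> int) \<Rightarrow> 'k ^ 'n \<Rightarrow> real" where
  "vnorm \<nu> v = (MAX i. vabs \<nu> (v $ i))"

context discrete_valuation
begin

lemma val_one: "\<nu> 1 = 0"
  using val_mult[of 1 1] by simp

lemma val_uminus: "\<nu> (- x) = \<nu> x"
  using val_mult[of "-1" "-1"] val_mult[of "-1" x] val_one by (cases "x = 0") simp_all

lemma cring_valuation_ring: "cring (valuation_ring \<nu>)"
proof -
  have add: "x + y = 0 \<or> \<nu> (x + y) \<ge> 0" if "x = 0 \<or> \<nu> x \<ge> 0" "y = 0 \<or> \<nu> y \<ge> 0" for x y
    using that val_add[of x y] by fastforce
  have mult: "x * y = 0 \<or> \<nu> (x * y) \<ge> 0" if "x = 0 \<or> \<nu> x \<ge> 0" "y = 0 \<or> \<nu> y \<ge> 0" for x y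
    using that val_mult[of x y] by fastforce
  have inv: "\<exists>y. (y = 0 \<or> \<nu> y \<ge> 0) \<and> y + x = 0" if "x = 0 \<or> \<nu> x \<ge> 0" for x
    using that val_uminus[of x] by (intro exI[of _ "- x"]) auto
  show ?thesis
    apply (rule cringI)
      apply (rule abelian_groupI)
           apply (use add mult inv val_one in \<open>auto simp: valuation_ring_def
             ring_of_type_algebra_def algebra_simps\<close>)[6]
     apply (rule comm_monoidI)
         apply (use add mult inv val_one in \<open>auto simp: valuation_ring_def
           ring_of_type_algebra_def algebra_simps\<close>)
    done
qed

lemma maximalideal_max_ideal: "maximalideal (max_ideal \<nu>) (valuation_ring \<nu>)"
proof -
  interpret cring "valuation_ring \<nu>" by (rule cring_valuation_ring)
  have ring_simps: "carrier (valuation_ring \<nu>) = {x. x = 0 \<or> \<nu> x \<ge> 0}"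
    "x \<oplus>\<^bsub>valuation_ring \<nu>\<^esub> y = x + y" "x \<otimes>\<^bsub>valuation_ring \<nu>\<^esub> y = x * y"
    "\<zero>\<^bsub>valuation_ring \<nu>\<^esub> = 0" "\<one>\<^bsub>valuation_ring \<nu>\<^esub> = 1" for x y
    by (simp_all add: valuation_ring_def ring_of_type_algebra_def)
  have minus: "\<ominus>\<^bsub>valuation_ring \<nu>\<^esub> x = - x" if "x = 0 \<or> \<nu> x \<ge> 0" for x
  proof (rule minus_equality)
    show "- x \<oplus>\<^bsub>valuation_ring \<nu>\<^esub> x = \<zero>\<^bsub>valuation_ring \<nu>\<^esub>" by (simp add: ring_simps)
  qed (use that val_uminus[of x] in \<open>auto simp: ring_simps\<close>)
  have add: "x + y = 0 \<or> \<nu> (x + y) > 0" if "x = 0 \<or> \<nu> x > 0" "y = 0 \<or> \<nu> y > 0" for x y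
    using that val_add[of x y] by fastforce
  have mult: "x * y = 0 \<or> \<nu> (x * y) > 0" if "x = 0 \<or> \<nu> x > 0" "y = 0 \<or> \<nu> y \<ge> 0" for x y
    using that val_mult[of x y] by fastforce
  have sub: "subgroup (max_ideal \<nu>) (add_monoid (valuation_ring \<nu>))"
  proof (rule add.subgroupI)
    fix x assume "x \<in> max_ideal \<nu>"
    then show "\<ominus>\<^bsub>valuation_ring \<nu>\<^esub> x \<in> max_ideal \<nu>"
      using minus[of x] val_uminus[of x] by (auto simp: max_ideal_def)
  qed (use add in \<open>auto simp: max_ideal_def ring_simps\<close>)
  have ideal: "ideal (max_ideal \<nu>) (valuation_ring \<nu>)"
    by (rule idealI[OF ring_axioms sub])
       (use mult in \<open>auto simp: max_ideal_def ring_simps mult.commute\<close>)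
  show ?thesis
  proof (rule maximalidealI[OF ideal])
    show "carrier (valuation_ring \<nu>) \<noteq> max_ideal \<nu>"
    proof -
      have "1 \<in> carrier (valuation_ring \<nu>)" "1 \<notin> max_ideal \<nu>"
        using val_one by (simp_all add: max_ideal_def ring_simps)
      then show ?thesis by blast
    qed
  next
    fix J assume J: "ideal J (valuation_ring \<nu>)" and mJ: "max_ideal \<nu> \<subseteq> J"
      and Jc: "J \<subseteq> carrier (valuation_ring \<nu>)"
    show "J = max_ideal \<nu> \<or> J = carrier (valuation_ring \<nu>)"
    proof (cases "J = max_ideal \<nu>")
      case False
      with mJ Jc obtain u where u: "u \<in> J" "u \<noteq> 0" "\<nu> u = 0"
        by (fastforce simp: max_ideal_def ring_simps)
      have "\<nu> (inverse u) = 0" using val_mult[of u "inverse u"] u val_one by simp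
      then have "inverse u \<otimes>\<^bsub>valuation_ring \<nu>\<^esub> u \<in> J"
        by (intro ideal.I_l_closed[OF J u(1)]) (simp add: ring_simps)
      then have "\<one>\<^bsub>valuation_ring \<nu>\<^esub> \<in> J" using u by (simp add: ring_simps)
      then show ?thesis using ideal.one_imp_carrier[OF J] by simp
    qed simp
  qed
qed

end


section \<open>Maximum size of a set with a given property\<close>

text \<open>The supremum is taken in the extended naturals, so that sets of unbounded size or an
  infinite set with the property give \<open>\<infinity>\<close>.\<close>

definition set_size :: "'a set \<Rightarrow> enat" where
  "set_size S = (if finite S then enat (card S) else \<infinity>)"

definition max_size :: "('a set \<Rightarrow> bool) \<Rightarrow> enat" where
  "max_size P = (SUP S\<in>{S. P S}. set_size S)"

lemma max_size_eq_enat_iff: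
  assumes "P {}"
  shows "max_size P = enat m \<longleftrightarrow>
    (\<exists>S. P S \<and> finite S \<and> card S = m) \<and> (\<forall>S. P S \<longrightarrow> finite S \<and> card S \<le> m)"
proof
  assume eq: "max_size P = enat m"
  have le: "set_size S \<le> enat m" if "P S" for S
    using that eq by (metis SUP_upper max_size_def mem_Collect_eq)
  then have fin: "finite S \<and> card S \<le> m" if "P S" for S
    using that by (fastforce simp: set_size_def split: if_splits)
  have "\<exists>S. P S \<and> card S = m"
  proof (rule ccontr)
    assume "\<nexists>S. P S \<and> card S = m"
    then have lt: "card S < m" if "P S" for S
      using fin that le_neq_implies_less by blast
    have "max_size P \<le> enat (m - 1)"
      unfolding max_size_def
      by (rule SUP_least) (use fin lt in \<open>fastforce simp: set_size_def\<close>)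
    with eq lt[OF assms] show False by auto
  qed
  with fin show "(\<exists>S. P S \<and> finite S \<and> card S = m) \<and> (\<forall>S. P S \<longrightarrow> finite S \<and> card S \<le> m)"
    by blast
next
  assume R: "(\<exists>S. P S \<and> finite S \<and> card S = m) \<and> (\<forall>S. P S \<longrightarrow> finite S \<and> card S \<le> m)"
  then obtain S where S: "P S" "finite S" "card S = m" by blast
  show "max_size P = enat m"
    unfolding max_size_def
  proof (rule antisym)
    show "(SUP S\<in>{S. P S}. set_size S) \<le> enat m"
      by (rule SUP_least) (use R in \<open>auto simp: set_size_def\<close>)
    show "enat m \<le> (SUP S\<in>{S. P S}. set_size S)"
      by (rule SUP_upper2[of S]) (use S in \<open>auto simp: set_size_def\<close>)
  qed
qed


section \<open>Orthogonality in \<open>K\<^sup>n\<close>\<close>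

text \<open>The empty family is excluded, as the maximum over it is undefined.\<close>

definition nonarch_orthogonal :: "('k::field \<Rightarrow> int) \<Rightarrow> ('k ^ 'n) set \<Rightarrow> bool" where
  "nonarch_orthogonal \<nu> E \<longleftrightarrow> finite E \<and> E \<noteq> {} \<and> 0 \<notin> E \<and>
     (\<forall>c. vnorm \<nu> (\<Sum>u\<in>E. c u *s u) = (MAX u\<in>E. vnorm \<nu> (c u *s u)))"

definition weakly_orthogonal :: "('k::field \<Rightarrow> int) \<Rightarrow> ('k ^ 'n) set \<Rightarrow> bool" where
  "weakly_orthogonal \<nu> S \<longleftrightarrow>
     (\<forall>u\<in>S. \<forall>v\<in>S. u \<noteq> v \<longrightarrow> nonarch_orthogonal \<nu> {u, v})"

definition strongly_orthogonal ::
    "('k::field \<Rightarrow> int) \<Rightarrow> nat \<Rightarrow> nat \<Rightarrow> ('k ^ 'n) set \<Rightarrow> bool" where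
  "strongly_orthogonal \<nu> k l S \<longleftrightarrow>
     0 \<notin> S \<and> weakly_orthogonal \<nu> S \<and>
     (\<forall>E\<subseteq>S. finite E \<and> card E = k \<longrightarrow> (\<exists>F\<subseteq>E. card F = l \<and> nonarch_orthogonal \<nu> F))"

definition Gamma_max ::
    "('k::field \<Rightarrow> int) \<Rightarrow> 'n::finite itself \<Rightarrow> nat \<Rightarrow> nat \<Rightarrow> enat" where
  "Gamma_max \<nu> (_ :: 'n itself) k l =
     max_size (strongly_orthogonal \<nu> k l :: ('k ^ 'n) set \<Rightarrow> bool)"


section \<open>Pro-independence\<close>

definition proj_space :: "('f::field ^ 'n) set set" where
  "proj_space = {L. vec.subspace L \<and> vec.dim L = 1}"

text \<open>The function \<open>r\<close> chooses a lift of each point.\<close>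

definition points_independent :: "('f::field ^ 'n) set set \<Rightarrow> bool" where
  "points_independent Y \<longleftrightarrow>
     (\<exists>r. (\<forall>L\<in>Y. r L \<in> L - {0}) \<and> inj_on r Y \<and> vec.independent (r ` Y))"

definition pro_independent :: "nat \<Rightarrow> nat \<Rightarrow> ('f::field ^ 'n) set set \<Rightarrow> bool" where
  "pro_independent k l S \<longleftrightarrow> S \<subseteq> proj_space \<and>
     (\<forall>Z\<subseteq>S. finite Z \<and> card Z = k \<longrightarrow> (\<exists>Y\<subseteq>Z. card Y = l \<and> points_independent Y))"

definition Ind_pro ::
    "'f::{field,finite} itself \<Rightarrow> 'n::finite itself \<Rightarrow> nat \<Rightarrow> nat \<Rightarrow> enat" where
  "Ind_pro (_ :: 'f itself) (_ :: 'n itself) k l =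
     max_size (pro_independent k l :: ('f ^ 'n) set set \<Rightarrow> bool)"

lemma contains_points_independent_iff:
  fixes Z :: "('f::field ^ 'n) set set"
  assumes Z: "Z \<subseteq> proj_space" "finite Z"
  shows "(\<exists>Y\<subseteq>Z. card Y = l \<and> points_independent Y) \<longleftrightarrow> l \<le> vec.dim (\<Union>Z)"
proof
  assume "\<exists>Y\<subseteq>Z. card Y = l \<and> points_independent Y"
  then obtain Y r where Y: "Y \<subseteq> Z" "card Y = l" "\<forall>L\<in>Y. r L \<in> L - {0}" "inj_on r Y"
    "vec.independent (r ` Y)" by (auto simp: points_independent_def)
  have "r ` Y \<subseteq> \<Union>Z" using Y by auto
  then have "card (r ` Y) \<le> vec.dim (\<Union>Z)"
    using vec.independent_card_le_dim Y(5) by blast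
  with Y show "l \<le> vec.dim (\<Union>Z)" by (simp add: card_image)
next
  assume l: "l \<le> vec.dim (\<Union>Z)"
  have "vec.subspace L" "\<exists>v\<in>L. v \<noteq> 0 \<and> L = vec.span {v}" if "L \<in> Z" for L
  proof -
    show s: "vec.subspace L" using that Z by (auto simp: proj_space_def)
    have d: "vec.dim L = 1" using that Z by (auto simp: proj_space_def)
    obtain B where B: "B \<subseteq> L" "vec.independent B" "L \<subseteq> vec.span B" "card B = vec.dim L"
      using vec.basis_exists by blast
    then obtain v where v: "B = {v}" using d card_1_singletonE by metis
    have "v \<noteq> 0" using B v by auto
    moreover have "vec.span {v} \<subseteq> L" using B v s by (simp add: vec.span_minimal)
    ultimately show "\<exists>v\<in>L. v \<noteq> 0 \<and> L = vec.span {v}" using B v by auto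
  qed
  then obtain r where r: "\<And>L. L \<in> Z \<Longrightarrow> r L \<in> L \<and> r L \<noteq> 0 \<and> L = vec.span {r L}" by metis
  have inj: "inj_on r Z" by (metis inj_onI r)
  have "\<Union>Z \<subseteq> vec.span (r ` Z)"
    using r by (metis Union_least empty_subsetI image_eqI insert_subset vec.span_mono)
  moreover have "vec.dim (r ` Z) = vec.dim (vec.span (r ` Z))" by simp
  ultimately have "vec.dim (\<Union>Z) \<le> vec.dim (r ` Z)" by (metis vec.dim_subset)
  moreover obtain B where B: "B \<subseteq> r ` Z" "vec.independent B" "card B = vec.dim (r ` Z)"
    using vec.basis_exists by metis
  ultimately have "l \<le> card B" using l by simp
  then obtain C where C: "C \<subseteq> B" "card C = l" by (meson obtain_subset_with_card_n)
  have "C \<subseteq> r ` Z" using B C by auto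
  then obtain Y where Y: "Y \<subseteq> Z" "C = r ` Y" by (meson subset_imageE)
  have "points_independent Y"
    unfolding points_independent_def
    using r Y(1) inj_on_subset[OF inj Y(1)] vec.independent_mono[OF B(2) C(1)] Y(2)
    by (intro exI[of _ r]) auto
  moreover have "card Y = l"
    using C Y inj by (metis card_image inj_on_subset)
  ultimately show "\<exists>Y\<subseteq>Z. card Y = l \<and> points_independent Y" using Y by blast
qed

end

(* Scale a nonzero vector of K^n to norm 1 and reduce it modulo the maximal ideal: this gives a
   nonzero vector of F_q^n, hence a projective point. A finite set of nonzero vectors is orthogonal
   if and only if the reductions are linearly independent: a nontrivial relation between the
   reductions lifts to a combination with coefficients of maximal absolute value 1 but of norm
   less than 1, and conversely any combination can be scaled so that its largest coefficient is a
   unit. So weakly orthogonal sets correspond to sets of projective points of the same size, and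
   strong orthogonality corresponds to pro-independence. *)

theory Submission
  imports Defs
begin

section \<open>Linearly independent families\<close>

text \<open>A family rather than a set: distinct vectors can have equal reductions, and such a
  repetition must count as a dependence, which the image set would hide.\<close>

definition independent_family :: "('b \<Rightarrow> 'f::field ^ 'n) \<Rightarrow> 'b set \<Rightarrow> bool" where
  "independent_family f A \<longleftrightarrow> (\<forall>d. (\<Sum>x\<in>A. d x *s f x) = 0 \<longrightarrow> (\<forall>x\<in>A. d x = 0))"

lemma independent_familyD:
  "independent_family f A \<Longrightarrow> (\<Sum>x\<in>A. d x *s f x) = 0 \<Longrightarrow> x \<in> A \<Longrightarrow> d x = 0"
  by (auto simp: independent_family_def)

lemma independent_family_iff:
  fixes f :: "'b \<Rightarrow> 'f::field ^ 'n"
  assumes A: "finite A"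
  shows "independent_family f A \<longleftrightarrow> inj_on f A \<and> vec.independent (f ` A)"
proof
  assume I: "independent_family f A"
  have inj: "inj_on f A"
  proof (rule inj_onI, rule ccontr)
    fix x y assume xy: "x \<in> A" "y \<in> A" "f x = f y" "x \<noteq> y"
    \<comment> \<open>The relation \<open>f x - f y = 0\<close>, written as a coefficient function
      supported on \<open>x\<close> and \<open>y\<close>.\<close>
    define d :: "'b \<Rightarrow> 'f" where "d z = (if z = x then 1 else if z = y then - 1 else 0)" for z
    have "(\<Sum>z\<in>A. d z *s f z) = (\<Sum>z\<in>{x, y}. d z *s f z)"
      by (rule sum.mono_neutral_right) (use A xy in \<open>auto simp: d_def\<close>)
    also have "\<dots> = 0" using xy by (simp add: d_def vec_eq_iff)
    finally have "d x = 0" by (rule independent_familyD[OF I]) (rule xy)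
    then show False by (simp add: d_def)
  qed
  moreover have "vec.independent (f ` A)"
  proof
    assume "vec.dependent (f ` A)"
    then obtain u v where u: "v \<in> f ` A" "u v \<noteq> 0" "(\<Sum>v\<in>f ` A. u v *s v) = 0"
      using vec.dependent_finite[of "f ` A"] A by auto
    from u(3) have "(\<Sum>x\<in>A. u (f x) *s f x) = 0" by (simp add: sum.reindex[OF inj])
    with u show False using independent_familyD[OF I, of "u \<circ> f"] by auto
  qed
  ultimately show "inj_on f A \<and> vec.independent (f ` A)" by blast
next
  assume R: "inj_on f A \<and> vec.independent (f ` A)"
  show "independent_family f A"
    unfolding independent_family_def
  proof (intro allI impI ballI)
    fix d x assume d: "(\<Sum>x\<in>A. d x *s f x) = 0" and x: "x \<in> A"
    have "(\<Sum>v\<in>f ` A. d (inv_into A f v) *s v) = 0"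
      using d R by (simp add: sum.reindex)
    then have "d (inv_into A f (f x)) = 0"
      using vec.independentD[of "f ` A" "f ` A" "\<lambda>v. d (inv_into A f v)" "f x"] A R x by simp
    with x R show "d x = 0" by simp
  qed
qed

text \<open>A relation for \<open>g\<close> with coefficients \<open>d x\<close> is one for
  \<open>f\<close> with coefficients \<open>d x / a x\<close>. This permits a change of lifts of
  projective points.\<close>

lemma independent_family_scale:
  fixes f g :: "'b \<Rightarrow> 'f::field ^ 'n"
  assumes I: "independent_family f A" and g: "\<And>x. x \<in> A \<Longrightarrow> f x = a x *s g x"
    and a: "\<And>x. x \<in> A \<Longrightarrow> a x \<noteq> 0"
  shows "independent_family g A"
  unfolding independent_family_def
proof (intro allI impI ballI)
  fix d x assume d: "(\<Sum>x\<in>A. d x *s g x) = 0" and x: "x \<in> A"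
  have "(\<Sum>x\<in>A. (d x / a x) *s f x) = (\<Sum>x\<in>A. d x *s g x)"
    by (rule sum.cong) (use g a in \<open>auto simp: vector_smult_assoc\<close>)
  with d have "d x / a x = 0" using independent_familyD[OF I, of "\<lambda>x. d x / a x"] x by simp
  with a x show "d x = 0" by simp
qed

lemma span_singleton_eqI:
  fixes a b :: "'f::field ^ 'n"
  assumes "a \<noteq> 0" "a \<in> vec.span {b}"
  shows "vec.span {a} = vec.span {b}"
proof -
  obtain c where c: "a = c *s b" using assms by (auto simp: vec.span_singleton)
  with assms have "c \<noteq> 0" by auto
  with c have b: "b = inverse c *s a" by (simp add: vector_smult_assoc)
  show ?thesis
  proof (rule antisym; rule vec.span_minimal)
    show "{b} \<subseteq> vec.span {a}" unfolding b by (simp add: vec.span_scale vec.span_base)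
  qed (use assms in auto)
qed

text \<open>If one nonzero vector is a multiple of another, the factor is invertible and the lines
  coincide. This is what turns weak orthogonality into distinctness of points.\<close>

lemma independent_family_pair_iff:
  fixes f :: "'b \<Rightarrow> 'f::field ^ 'n"
  assumes "x \<noteq> y" "f x \<noteq> 0" "f y \<noteq> 0"
  shows "independent_family f {x, y} \<longleftrightarrow> vec.span {f x} \<noteq> vec.span {f y}"
proof -
  have "f x \<in> vec.span {f y} \<longleftrightarrow> vec.span {f x} = vec.span {f y}"
    using span_singleton_eqI[of "f x" "f y"] assms vec.span_base[of "f x" "{f x}"] by blast
  then show ?thesis
    using assms by (auto simp: independent_family_iff vec.independent_insert vec.span_base)
qed

section \<open>Points of projective space and their lifts\<close>

lemma span_singleton_in_proj_space: "v \<noteq> 0 \<Longrightarrow> vec.span {v} \<in> proj_space"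
  using vec.dim_eq_card_independent[of "{v}"] by (simp add: proj_space_def)

lemma proj_space_obtain:
  fixes L :: "('f::field ^ 'n) set"
  assumes "L \<in> proj_space"
  obtains v where "v \<noteq> 0" "L = vec.span {v}"
proof -
  have s: "vec.subspace L" and d: "vec.dim L = 1" using assms by (auto simp: proj_space_def)
  obtain B where B: "B \<subseteq> L" "vec.independent B" "L \<subseteq> vec.span B" "card B = vec.dim L"
    using vec.basis_exists by blast
  then obtain v where v: "B = {v}" using d card_1_singletonE by metis
  show thesis
  proof
    show "v \<noteq> 0" using B v by auto
    show "L = vec.span {v}" using B v s by (simp add: vec.span_minimal subset_antisym)
  qed
qed

text \<open>Every lift of the point spanned by \<open>f x\<close> is a nonzero multiple of
  \<open>f x\<close>, so independence can be tested on the particular lifts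
  \<open>f\<close>.\<close>

lemma points_independent_iff:
  fixes f :: "'b \<Rightarrow> 'f::field ^ 'n"
  assumes A: "finite A" and inj: "inj_on (\<lambda>x. vec.span {f x}) A"
    and nz: "\<And>x. x \<in> A \<Longrightarrow> f x \<noteq> 0"
  shows "points_independent ((\<lambda>x. vec.span {f x}) ` A) \<longleftrightarrow> independent_family f A"
proof -
  define P where "P x = vec.span {f x}" for x
  have inj: "inj_on P A" using inj by (simp add: P_def[abs_def])
  have "points_independent (P ` A) \<longleftrightarrow> independent_family f A"
  proof
    assume "points_independent (P ` A)"
    then obtain r where r: "\<forall>L\<in>P ` A. r L \<in> L - {0}" "inj_on r (P ` A)" "vec.independent (r ` P ` A)"
      by (auto simp: points_independent_def)
    have I: "independent_family (r \<circ> P) A"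
      using r inj A by (simp add: independent_family_iff comp_inj_on image_comp)
    have "\<exists>a. a \<noteq> 0 \<and> (r \<circ> P) x = a *s f x" if "x \<in> A" for x
      using r(1) that by (force simp: P_def vec.span_singleton)
    then obtain a where "\<And>x. x \<in> A \<Longrightarrow> a x \<noteq> 0 \<and> (r \<circ> P) x = a x *s f x" by metis
    then show "independent_family f A" by (intro independent_family_scale[OF I, of a]) auto
  next
    assume I: "independent_family f A"
    \<comment> \<open>\<open>f\<close> itself supplies the lifts; injectivity of \<open>P\<close>
      lets a point recover its index.\<close>
    define r where "r L = f (inv_into A P L)" for L
    have r: "r (P x) = f x" if "x \<in> A" for x using inj that by (simp add: r_def)
    show "points_independent (P ` A)"
      unfolding points_independent_def
    proof (intro exI conjI)
      show "\<forall>L\<in>P ` A. r L \<in> L - {0}" using nz by (auto simp: r) (simp add: P_def vec.span_base)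
      show "inj_on r (P ` A)"
        using I A by (auto simp: independent_family_iff r intro!: inj_onI dest: inj_onD)
      have "r ` P ` A = f ` A" using r by (simp add: image_comp)
      then show "vec.independent (r ` P ` A)" using I A by (simp add: independent_family_iff)
    qed
  qed
  then show ?thesis by (simp add: P_def[abs_def])
qed


section \<open>Absolute value and norm\<close>

text \<open>The residue isomorphism in the form used below: reduction is a total map on the field,
  specified on the valuation ring only. The cardinality condition makes the base of
  \<open>vabs\<close> exceed 1, so that \<open>vabs\<close> strictly decreases as the valuation
  grows.\<close>

locale residue_map = discrete_valuation \<nu>
  for \<nu> :: "'k::field \<Rightarrow> int" +
  fixes red :: "'k \<Rightarrow> 'f::field"
  assumes card_residue_field: "card (carrier (residue_field \<nu>)) > 1"
    and red_add: "x \<in> carrier (valuation_ring \<nu>) \<Longrightarrow> y \<in> carrier (valuation_ring \<nu>) \<Longrightarrow>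
      red (x + y) = red x + red y"
    and red_mult: "x \<in> carrier (valuation_ring \<nu>) \<Longrightarrow> y \<in> carrier (valuation_ring \<nu>) \<Longrightarrow>
      red (x * y) = red x * red y"
    and red_eq_0_iff: "x \<in> carrier (valuation_ring \<nu>) \<Longrightarrow> red x = 0 \<longleftrightarrow> x \<in> max_ideal \<nu>"
    and red_surj: "red ` carrier (valuation_ring \<nu>) = UNIV"
begin

lemma vabs_0 [simp]: "vabs \<nu> 0 = 0"
  by (simp add: vabs_def)

lemma vabs_1 [simp]: "vabs \<nu> 1 = 1"
  by (simp add: vabs_def val_one)

lemma vabs_nonneg [simp]: "0 \<le> vabs \<nu> x"
  by (simp add: vabs_def)

lemma vabs_eq_0_iff [simp]: "vabs \<nu> x = 0 \<longleftrightarrow> x = 0"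
  using card_residue_field by (auto simp: vabs_def)

lemma vabs_mult: "vabs \<nu> (x * y) = vabs \<nu> x * vabs \<nu> y"
  using card_residue_field by (simp add: vabs_def val_mult power_int_add[symmetric] add.commute)

lemma vabs_inverse: "vabs \<nu> (inverse x) = inverse (vabs \<nu> x)"
  using vabs_mult[of x "inverse x"] by (cases "x = 0") (simp_all add: field_simps)

text \<open>Powers of a base above 1 increase with the exponent, so \<open>val_add\<close> becomes
  the ultrametric inequality. The cases involving 0, which \<open>val_add\<close> does not cover,
  are treated apart.\<close>

lemma vabs_add_le: "vabs \<nu> (x + y) \<le> max (vabs \<nu> x) (vabs \<nu> y)"
proof (cases "x = 0 \<or> y = 0 \<or> x + y = 0")
  case False
  have "- \<nu> (x + y) \<le> - \<nu> x \<or> - \<nu> (x + y) \<le> - \<nu> y" using val_add[of x y] False by auto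
  with False card_residue_field show ?thesis
    by (auto simp: vabs_def le_max_iff_disj intro!: power_int_increasing)
qed (auto simp: le_max_iff_disj)

lemma vabs_less_eq_1_iff:
  assumes "x \<noteq> 0"
  shows "vabs \<nu> x < 1 \<longleftrightarrow> \<nu> x > 0" "vabs \<nu> x \<le> 1 \<longleftrightarrow> \<nu> x \<ge> 0"
  using assms card_residue_field
    power_int_strict_increasing[of 0 "- \<nu> x" "real (card (carrier (residue_field \<nu>)))"]
    power_int_strict_increasing[of "- \<nu> x" 0 "real (card (carrier (residue_field \<nu>)))"]
  by (cases "\<nu> x" "0 :: int" rule: linorder_cases; simp add: vabs_def)+

lemma carrier_valuation_ring: "x \<in> carrier (valuation_ring \<nu>) \<longleftrightarrow> vabs \<nu> x \<le> 1"
  by (cases "x = 0") (simp_all add: valuation_ring_def vabs_less_eq_1_iff)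

lemma max_ideal_iff: "x \<in> max_ideal \<nu> \<longleftrightarrow> vabs \<nu> x < 1"
  by (cases "x = 0") (simp_all add: max_ideal_def vabs_less_eq_1_iff)

lemma red_eq_0: "vabs \<nu> x \<le> 1 \<Longrightarrow> red x = 0 \<longleftrightarrow> vabs \<nu> x < 1"
  by (simp add: red_eq_0_iff carrier_valuation_ring max_ideal_iff)

lemma vnorm_le_iff: "vnorm \<nu> v \<le> r \<longleftrightarrow> (\<forall>i. vabs \<nu> (v $ i) \<le> r)"
  by (simp add: vnorm_def)

lemma vnorm_less_iff: "vnorm \<nu> v < r \<longleftrightarrow> (\<forall>i. vabs \<nu> (v $ i) < r)"
  by (simp add: vnorm_def)

lemma vabs_component_le: "vabs \<nu> (v $ i) \<le> vnorm \<nu> v"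
  using vnorm_le_iff by blast

lemma vnorm_attained: "\<exists>i. vnorm \<nu> v = vabs \<nu> (v $ i)"
proof -
  have "vnorm \<nu> v \<in> range (\<lambda>i. vabs \<nu> (v $ i))" unfolding vnorm_def by (rule Max_in) auto
  then show ?thesis by auto
qed

lemma vnorm_nonneg [simp]: "0 \<le> vnorm \<nu> v"
  using vnorm_attained[of v] by auto

lemma vnorm_0 [simp]: "vnorm \<nu> 0 = 0"
  by (simp add: vnorm_def)

lemma vnorm_eq_0_iff [simp]: "vnorm \<nu> v = 0 \<longleftrightarrow> v = 0"
proof
  assume "vnorm \<nu> v = 0"
  then have "vabs \<nu> (v $ i) = 0" for i
    using vabs_component_le[of v i] vabs_nonneg[of "v $ i"] by linarith
  then show "v = 0" by (simp add: vec_eq_iff)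
qed simp

lemma vnorm_smult: "vnorm \<nu> (a *s v) = vabs \<nu> a * vnorm \<nu> v"
proof (rule antisym)
  show "vnorm \<nu> (a *s v) \<le> vabs \<nu> a * vnorm \<nu> v"
    by (simp add: vnorm_le_iff vabs_mult mult_left_mono vabs_component_le)
  obtain i where "vnorm \<nu> v = vabs \<nu> (v $ i)" using vnorm_attained by blast
  then show "vabs \<nu> a * vnorm \<nu> v \<le> vnorm \<nu> (a *s v)"
    using vabs_component_le[of "a *s v" i] by (simp add: vabs_mult)
qed

lemma vnorm_smult_le_1: "vabs \<nu> a \<le> 1 \<Longrightarrow> vnorm \<nu> v \<le> 1 \<Longrightarrow> vnorm \<nu> (a *s v) \<le> 1"
  by (simp add: vnorm_smult mult_le_one)

lemma vnorm_add_le: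
  assumes "vnorm \<nu> v \<le> r" "vnorm \<nu> w \<le> r"
  shows "vnorm \<nu> (v + w) \<le> r"
  unfolding vnorm_le_iff
proof
  fix i
  show "vabs \<nu> ((v + w) $ i) \<le> r"
    using vabs_add_le[of "v $ i" "w $ i"] assms vabs_component_le[of v i] vabs_component_le[of w i]
    by auto
qed

lemma vnorm_sum_le:
  assumes "0 \<le> r" "\<And>x. x \<in> A \<Longrightarrow> vnorm \<nu> (f x) \<le> r"
  shows "vnorm \<nu> (\<Sum>x\<in>A. f x) \<le> r"
  using assms by (induction A rule: infinite_finite_induct) (simp_all add: vnorm_add_le)


section \<open>Reduction of vectors\<close>

definition vred :: "'k ^ 'n \<Rightarrow> 'f ^ 'n" where
  "vred v = (\<chi> i. red (v $ i))"

lemma vred_add: "vnorm \<nu> v \<le> 1 \<Longrightarrow> vnorm \<nu> w \<le> 1 \<Longrightarrow> vred (v + w) = vred v + vred w"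
  by (simp add: vred_def vec_eq_iff red_add carrier_valuation_ring vnorm_le_iff)

lemma vred_smult: "vabs \<nu> a \<le> 1 \<Longrightarrow> vnorm \<nu> v \<le> 1 \<Longrightarrow> vred (a *s v) = red a *s vred v"
  by (simp add: vred_def vec_eq_iff red_mult carrier_valuation_ring vnorm_le_iff)

text \<open>The norm is a maximum over coordinates, and a coordinate of the valuation ring reduces
  to 0 exactly when its absolute value is below 1.\<close>

lemma vred_eq_0_iff:
  assumes "vnorm \<nu> v \<le> 1"
  shows "vred v = 0 \<longleftrightarrow> vnorm \<nu> v < 1"
proof -
  have "vabs \<nu> (v $ i) \<le> 1" for i using assms by (simp add: vnorm_le_iff)
  then show ?thesis by (simp add: vred_def vec_eq_iff vnorm_less_iff red_eq_0)
qed

text \<open>The ultrametric inequality keeps all partial sums in the unit ball, so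
  \<open>vred_add\<close> applies at every step of the induction.\<close>

lemma vred_sum:
  "(\<And>x. x \<in> A \<Longrightarrow> vnorm \<nu> (f x) \<le> 1) \<Longrightarrow> vred (\<Sum>x\<in>A. f x) = (\<Sum>x\<in>A. vred (f x))"
  by (induction A rule: infinite_finite_induct)
    (simp_all add: vred_add vnorm_sum_le vred_eq_0_iff)

lemma vred_lincomb:
  assumes "\<And>x. x \<in> A \<Longrightarrow> vabs \<nu> (c x) \<le> 1" "\<And>x. x \<in> A \<Longrightarrow> vnorm \<nu> (f x) \<le> 1"
  shows "vred (\<Sum>x\<in>A. c x *s f x) = (\<Sum>x\<in>A. red (c x) *s vred (f x))"
  using assms by (subst vred_sum) (auto simp: vnorm_smult_le_1 vred_smult intro!: sum.cong)

text \<open>The norm is attained at a coordinate, so the inverse of that coordinate is a scalar that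
  brings a nonzero \<open>v\<close> to norm 1. For \<open>v = 0\<close> the scalar is 0.\<close>

definition scaling :: "'k ^ 'n \<Rightarrow> 'k" where
  "scaling v = inverse (v $ (SOME i. vnorm \<nu> v = vabs \<nu> (v $ i)))"

lemma vabs_scaling: "vabs \<nu> (scaling v) = inverse (vnorm \<nu> v)"
  using someI_ex[OF vnorm_attained[of v]] by (simp add: scaling_def vabs_inverse)

lemma scaling_nonzero: "v \<noteq> 0 \<Longrightarrow> scaling v \<noteq> 0"
  using vabs_scaling[of v] by auto

lemma vnorm_normalized: "v \<noteq> 0 \<Longrightarrow> vnorm \<nu> (scaling v *s v) = 1"
  by (simp add: vnorm_smult vabs_scaling)

lemma vnorm_normalized_le: "vnorm \<nu> (scaling v *s v) \<le> 1"
  by (cases "v = 0") (simp_all add: vnorm_normalized)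

text \<open>Another maximal coordinate in \<open>scaling\<close> would change this vector by a
  nonzero factor; only the line that it spans is canonical.\<close>

definition reduction :: "'k ^ 'n \<Rightarrow> 'f ^ 'n" where
  "reduction v = vred (scaling v *s v)"

lemma reduction_nonzero: "v \<noteq> 0 \<Longrightarrow> reduction v \<noteq> 0"
  by (simp add: reduction_def vred_eq_0_iff vnorm_normalized)

lemma red_surjE:
  obtains x where "vabs \<nu> x \<le> 1" "red x = y"
proof -
  have "y \<in> red ` carrier (valuation_ring \<nu>)" by (simp add: red_surj)
  then show thesis using that by (auto simp: carrier_valuation_ring)
qed

section \<open>Orthogonality as independence of reductions\<close>

lemma orthogonal_iff_independent_reduction:
  fixes E :: "('k ^ 'n) set"
  assumes E: "finite E" "E \<noteq> {}" "0 \<notin> E"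
  shows "nonarch_orthogonal \<nu> E \<longleftrightarrow> independent_family reduction E"
proof
  assume orth: "nonarch_orthogonal \<nu> E"
  show "independent_family reduction E"
    unfolding independent_family_def
  proof (intro allI impI ballI, rule ccontr)
    fix d x assume d: "(\<Sum>u\<in>E. d u *s reduction u) = 0" and x: "x \<in> E" "d x \<noteq> 0"
    have "\<exists>c. vabs \<nu> c \<le> 1 \<and> red c = d u" for u using red_surjE by metis
    then obtain c where c: "\<And>u. vabs \<nu> (c u) \<le> 1" "\<And>u. red (c u) = d u" by metis
    \<comment> \<open>The lifted relation. Including \<open>scaling u\<close> in the coefficient
      gives each term the norm \<open>vabs \<nu> (c u)\<close>.\<close>
    define s where "s = (\<Sum>u\<in>E. (c u * scaling u) *s u)"
    have vn: "vnorm \<nu> ((c u * scaling u) *s u) = vabs \<nu> (c u)" if "u \<in> E" for u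
      using that E vnorm_normalized[of u] by (auto simp: vnorm_smult vabs_mult mult.assoc)
    have le: "vnorm \<nu> s \<le> 1" unfolding s_def by (rule vnorm_sum_le) (use vn c in auto)
    have "vred s = (\<Sum>u\<in>E. red (c u) *s vred (scaling u *s u))"
      unfolding s_def vector_smult_assoc[symmetric]
      by (rule vred_lincomb) (use c vnorm_normalized_le in auto)
    with d have "vred s = 0" by (simp add: c reduction_def)
    with le have "vnorm \<nu> s < 1" by (simp add: vred_eq_0_iff)
    moreover have "vnorm \<nu> s = (MAX u\<in>E. vnorm \<nu> ((c u * scaling u) *s u))"
      using orth by (simp add: nonarch_orthogonal_def s_def)
    moreover have "vnorm \<nu> ((c x * scaling x) *s x) \<le> (MAX u\<in>E. vnorm \<nu> ((c u * scaling u) *s u))"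
      using E x by (intro Max_ge) auto
    \<comment> \<open>Orthogonality bounds the term at \<open>x\<close> by the norm of
      \<open>s\<close>, which is below 1; hence \<open>c x\<close> would reduce to 0, although
      \<open>d x\<close> is nonzero.\<close>
    ultimately have "vabs \<nu> (c x) < 1" using vn x by simp
    with c x show False using red_eq_0[of "c x"] by simp
  qed
next
  assume I: "independent_family reduction E"
  have "vnorm \<nu> (\<Sum>u\<in>E. c u *s u) = (MAX u\<in>E. vnorm \<nu> (c u *s u))" for c
  proof -
    define M where "M = (MAX u\<in>E. vnorm \<nu> (c u *s u))"
    have M: "vnorm \<nu> (c u *s u) \<le> M" if "u \<in> E" for u
      using E that by (simp add: M_def)
    have "M \<in> (\<lambda>u. vnorm \<nu> (c u *s u)) ` E" unfolding M_def by (rule Max_in) (use E in auto)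
    then obtain x where x: "x \<in> E" "M = vnorm \<nu> (c x *s x)" by blast
    have x0: "x \<noteq> 0" using x E by auto
    have le: "vnorm \<nu> (\<Sum>u\<in>E. c u *s u) \<le> M"
      by (rule vnorm_sum_le) (use M x in auto)
    show ?thesis
    \<comment> \<open>For \<open>M = 0\<close> the norm of the sum lies between 0 and
      \<open>M\<close>. Otherwise dividing by a scalar of absolute value \<open>M\<close> is
      possible.\<close>
    proof (cases "M = 0")
      case True
      with le show ?thesis unfolding M_def[symmetric]
        using vnorm_nonneg[of "\<Sum>u\<in>E. c u *s u"] by linarith
    next
      case False
      then have cx: "c x \<noteq> 0" using x by auto
      \<comment> \<open>\<open>t\<close> has absolute value \<open>M\<close> and is chosen so that,
        relative to the normalized vectors, the coefficient \<open>b x\<close> of a largest term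
        becomes exactly 1.\<close>
      define t where "t = c x / scaling x"
      define b where "b u = c u / (scaling u * t)" for u
      have t: "t \<noteq> 0" using cx scaling_nonzero[OF x0] by (simp add: t_def)
      have vt: "vabs \<nu> t = M"
        using x by (simp add: t_def divide_inverse vabs_mult vabs_inverse vabs_scaling vnorm_smult)
      have bx: "b x = 1" using cx scaling_nonzero[OF x0] by (simp add: b_def t_def)
      have cb: "c u *s u = t *s (b u *s (scaling u *s u))" if "u \<in> E" for u
        using scaling_nonzero[of u] t that E by (auto simp: b_def vector_smult_assoc)
      \<comment> \<open>The term at \<open>u\<close> has norm \<open>M * vabs \<nu> (b u)\<close>
        and is bounded by \<open>M\<close>, which is positive and cancels.\<close>
      have b: "vabs \<nu> (b u) \<le> 1" if "u \<in> E" for u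
      proof -
        have "u \<noteq> 0" using that E by auto
        then have "vnorm \<nu> (c u *s u) = M * vabs \<nu> (b u)"
          unfolding cb[OF that]
          by (simp only: vnorm_smult[of t] vnorm_smult[of "b u"] vnorm_normalized[OF \<open>u \<noteq> 0\<close>]
              vt mult_1_right)
        with M[OF that] have "M * vabs \<nu> (b u) \<le> M * 1" by simp
        with False vabs_nonneg[of t] vt show ?thesis by (simp add: mult_le_cancel_left)
      qed
      define s where "s = (\<Sum>u\<in>E. b u *s (scaling u *s u))"
      have "vnorm \<nu> s \<le> 1" 
        unfolding s_def by (rule vnorm_sum_le, simp, rule vnorm_smult_le_1, erule b, rule vnorm_normalized_le)
      \<comment> \<open>A vanishing reduction would be a relation whose coefficient at
        \<open>x\<close> is \<open>red 1\<close>, and this is nonzero because 1 has absolute value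
        1.\<close>
      moreover have "vred s \<noteq> 0"
      proof
        assume "vred s = 0"
        moreover have "vred s = (\<Sum>u\<in>E. red (b u) *s vred (scaling u *s u))"
          unfolding s_def by (rule vred_lincomb) (use b vnorm_normalized_le in auto)
        ultimately have "(\<Sum>u\<in>E. red (b u) *s reduction u) = 0" by (simp add: reduction_def)
        then have "red (b x) = 0" using independent_familyD[OF I, of "\<lambda>u. red (b u)"] x by simp
        with bx show False using red_eq_0[of 1] by simp
      qed
      ultimately have "vnorm \<nu> s = 1" by (simp add: vred_eq_0_iff)
      moreover have "(\<Sum>u\<in>E. c u *s u) = t *s s"
        by (simp add: s_def vec.scale_sum_right cb)
      ultimately show ?thesis by (simp add: vnorm_smult vt M_def)
    qed
  qed
  with E show "nonarch_orthogonal \<nu> E" by (simp add: nonarch_orthogonal_def)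
qed


section \<open>Strong orthogonality and pro-independence\<close>

definition point :: "'k ^ 'n \<Rightarrow> ('f ^ 'n) set" where
  "point v = vec.span {reduction v}"

text \<open>For two vectors, independence of the reductions means that they span different lines, so
  the pairwise condition separates the points.\<close>

lemma weakly_orthogonal_iff:
  assumes "0 \<notin> S"
  shows "weakly_orthogonal \<nu> S \<longleftrightarrow> inj_on point S"
proof -
  have "nonarch_orthogonal \<nu> {u, v} \<longleftrightarrow> point u \<noteq> point v" if "u \<in> S" "v \<in> S" "u \<noteq> v" for u v
  proof -
    have nz: "u \<noteq> 0" "v \<noteq> 0" using that assms by auto
    then have "nonarch_orthogonal \<nu> {u, v} \<longleftrightarrow> independent_family reduction {u, v}"
      by (intro orthogonal_iff_independent_reduction) auto
    with that nz show ?thesis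
      by (simp add: independent_family_pair_iff reduction_nonzero point_def)
  qed
  then show ?thesis unfolding weakly_orthogonal_def inj_on_def by blast
qed

lemma orthogonal_iff_points_independent:
  assumes "finite F" "F \<noteq> {}" "0 \<notin> F" "inj_on point F"
  shows "nonarch_orthogonal \<nu> F \<longleftrightarrow> points_independent (point ` F)"
proof -
  have "reduction v \<noteq> 0" if "v \<in> F" for v
    using that assms reduction_nonzero[of v] by auto
  then have "points_independent ((\<lambda>v. vec.span {reduction v}) ` F) \<longleftrightarrow> independent_family reduction F"
    using assms by (intro points_independent_iff) (auto simp: point_def[abs_def])
  with assms show ?thesis
    by (simp add: orthogonal_iff_independent_reduction point_def[abs_def])
qed

text \<open>An injective \<open>point\<close> carries subsets of \<open>S\<close> to subsets of the
  image with the same cardinality. Positivity of \<open>l\<close> keeps the chosen subsets nonempty,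
  as \<open>nonarch_orthogonal\<close> demands.\<close>

lemma strongly_orthogonal_iff:
  assumes l: "l > 0"
  shows "strongly_orthogonal \<nu> k l S \<longleftrightarrow>
    0 \<notin> S \<and> inj_on point S \<and> pro_independent k l (point ` S)"
\<comment> \<open>Outside this case both sides are false.\<close>
proof (cases "0 \<notin> S \<and> inj_on point S")
  case True
  have inj: "inj_on point A" if "A \<subseteq> S" for A using True that inj_on_subset by blast
  have card: "card (point ` A) = card A" if "A \<subseteq> S" for A using inj[OF that] card_image by blast
  have fin: "finite (point ` A) \<longleftrightarrow> finite A" if "A \<subseteq> S" for A
    using inj[OF that] finite_image_iff by blast
  have "(\<exists>F\<subseteq>E. card F = l \<and> nonarch_orthogonal \<nu> F) \<longleftrightarrow>
      (\<exists>Y\<subseteq>point ` E. card Y = l \<and> points_independent Y)" if "E \<subseteq> S" for E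
  proof -
    have "nonarch_orthogonal \<nu> F \<longleftrightarrow> points_independent (point ` F)"
      if "F \<subseteq> E" "card F = l" for F
      by (rule orthogonal_iff_points_independent)
        (use that True l \<open>E \<subseteq> S\<close> inj[of F] card_gt_0_iff[of F] in auto)
    moreover have "card (point ` F) = card F" if "F \<subseteq> E" for F
      using card that \<open>E \<subseteq> S\<close> by blast
    \<comment> \<open>Every subset of the image of \<open>E\<close> is the image of a subset of
      \<open>E\<close>.\<close>
    ultimately show ?thesis by (smt (verit) image_mono subset_image_iff subset_trans)
  qed
  moreover have "point v \<in> proj_space" if "v \<in> S" for v
    using True that reduction_nonzero[of v] unfolding point_def
    by (intro span_singleton_in_proj_space) auto
  ultimately show ?thesis
    unfolding strongly_orthogonal_def pro_independent_def all_subset_image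
    using True weakly_orthogonal_iff[of S] card fin by (auto simp: subset_eq)
qed (auto simp: strongly_orthogonal_def weakly_orthogonal_iff)

text \<open>A spanning vector of the line is lifted coordinate by coordinate; its reduction being
  nonzero forces the lift to have norm 1.\<close>

lemma point_surj:
  fixes L :: "('f ^ 'n) set"
  assumes "L \<in> proj_space"
  shows "\<exists>v. v \<noteq> 0 \<and> point v = L"
proof -
  obtain w where w: "w \<noteq> 0" "L = vec.span {w}" using proj_space_obtain[OF assms] .
  have "\<forall>i. \<exists>x. vabs \<nu> x \<le> 1 \<and> red x = w $ i" using red_surjE by metis
  then obtain f where f: "\<And>i. vabs \<nu> (f i) \<le> 1" "\<And>i. red (f i) = w $ i" by metis
  define v :: "'k ^ 'n" where "v = (\<chi> i. f i)"
  have vred: "vred v = w" by (simp add: vred_def v_def f vec_eq_iff)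
  have "vnorm \<nu> v \<le> 1" by (simp add: vnorm_le_iff v_def f)
  then have v1: "vnorm \<nu> v = 1" using vred_eq_0_iff[of v] vred w by simp
  then have v0: "v \<noteq> 0" by auto
  \<comment> \<open>Normalizing \<open>v\<close> may still multiply it by a scalar of absolute value
    1, so \<open>reduction v\<close> is a multiple of \<open>w\<close> and need not equal
    it.\<close>
  have "reduction v = red (scaling v) *s w"
    unfolding reduction_def by (subst vred_smult) (simp_all add: vabs_scaling v1 vred)
  then have "reduction v \<in> vec.span {w}" by (simp add: vec.span_scale vec.span_base)
  with v0 w show ?thesis
    using span_singleton_eqI reduction_nonzero unfolding point_def by blast
qed

text \<open>The two kinds of sets have the same attainable sizes, infinite ones included, so the
  suprema agree.\<close>

lemma max_strongly_orthogonal: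
  assumes l: "l > 0"
  shows "max_size (strongly_orthogonal \<nu> k l :: ('k ^ 'n) set \<Rightarrow> bool) =
    max_size (pro_independent k l :: ('f ^ 'n) set set \<Rightarrow> bool)"
proof -
  have size: "set_size (point ` S) = set_size S" if "inj_on point S" for S :: "('k ^ 'n) set"
    using that by (simp add: set_size_def finite_image_iff card_image)
  have "set_size ` Collect (strongly_orthogonal \<nu> k l :: ('k ^ 'n) set \<Rightarrow> bool) =
      set_size ` Collect (pro_independent k l :: ('f ^ 'n) set set \<Rightarrow> bool)"
  proof (rule subset_antisym; rule image_subsetI)
    fix S :: "('k ^ 'n) set" assume "S \<in> Collect (strongly_orthogonal \<nu> k l)"
    then show "set_size S \<in> set_size ` Collect (pro_independent k l :: ('f ^ 'n) set set \<Rightarrow> bool)"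
      using size[of S] l by (intro image_eqI[of _ _ "point ` S"]) (auto simp: strongly_orthogonal_iff)
  next
    fix T :: "('f ^ 'n) set set" assume T: "T \<in> Collect (pro_independent k l)"
    then have "\<forall>L\<in>T. \<exists>v. v \<noteq> 0 \<and> point v = L" using point_surj by (auto simp: pro_independent_def)
    \<comment> \<open>One vector over each point of \<open>T\<close>; as a right inverse of
      \<open>point\<close>, \<open>g\<close> has an image on which \<open>point\<close> is
      injective.\<close>
    then obtain g where g: "\<And>L. L \<in> T \<Longrightarrow> g L \<noteq> 0 \<and> point (g L) = L" by metis
    have inj: "inj_on point (g ` T)" using g by (auto intro!: inj_onI)
    have "point ` g ` T = T" using g by (force simp: image_comp)
    moreover from this T g inj l have "strongly_orthogonal \<nu> k l (g ` T)"
      by (auto simp: strongly_orthogonal_iff)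
    ultimately show "set_size T \<in>
        set_size ` Collect (strongly_orthogonal \<nu> k l :: ('k ^ 'n) set \<Rightarrow> bool)"
      using size[OF inj] by (intro image_eqI[of _ _ "g ` T"]) auto
  qed
  then show ?thesis by (simp add: max_size_def)
qed

end

section \<open>The reduction map coming from the residue isomorphism\<close>

lemma residue_map_exists:
  fixes \<nu> :: "'k::field \<Rightarrow> int"
  assumes "discrete_valuation \<nu>"
    and iso: "residue_field \<nu> \<simeq> (ring_of_type_algebra :: 'f::{field,finite} ring)"
  shows "\<exists>red :: 'k \<Rightarrow> 'f. residue_map \<nu> red"
proof -
  interpret discrete_valuation \<nu> by fact
  interpret I: maximalideal "max_ideal \<nu>" "valuation_ring \<nu>" by (rule maximalideal_max_ideal)
  \<comment> \<open>The quotient map onto cosets; followed by the isomorphism \<open>h\<close> it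
    gives the reduction.\<close>
  define cls where "cls x = max_ideal \<nu> +>\<^bsub>valuation_ring \<nu>\<^esub> x" for x
  have ops: "x \<oplus>\<^bsub>valuation_ring \<nu>\<^esub> y = x + y" "x \<otimes>\<^bsub>valuation_ring \<nu>\<^esub> y = x * y" for x y
    by (simp_all add: valuation_ring_def ring_of_type_algebra_def)
  obtain h where h: "h \<in> ring_iso (residue_field \<nu>) (ring_of_type_algebra :: 'f ring)"
    using iso by (auto simp: is_ring_iso_def)
  then have hom: "h \<in> ring_hom (residue_field \<nu>) (ring_of_type_algebra :: 'f ring)"
    and bij: "bij_betw h (carrier (residue_field \<nu>)) (UNIV :: 'f set)"
    by (auto simp: ring_iso_def ring_of_type_algebra_def)
  have ch: "cls \<in> ring_hom (valuation_ring \<nu>) (residue_field \<nu>)"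
    unfolding cls_def[abs_def] residue_field_def by (rule I.rcos_ring_hom)
  have surj: "carrier (residue_field \<nu>) = cls ` carrier (valuation_ring \<nu>)"
    by (auto simp: residue_field_def FactRing_def A_RCOSETS_def' cls_def)
  have zero: "\<zero>\<^bsub>residue_field \<nu>\<^esub> = max_ideal \<nu>" by (simp add: residue_field_def FactRing_def)
  interpret Q: ring "residue_field \<nu>" unfolding residue_field_def by (rule I.quotient_is_ring)
  interpret F: ring "ring_of_type_algebra :: 'f ring"
    by (rule ring_from_type_algebra)
  have h0: "h (\<zero>\<^bsub>residue_field \<nu>\<^esub>) = 0"
    using ring_hom_zero[OF hom Q.ring_axioms F.ring_axioms] by (simp add: ring_of_type_algebra_def)
  have "residue_map \<nu> (h \<circ> cls)"
  proof
    have "card (carrier (residue_field \<nu>)) = CARD('f)" using bij by (rule bij_betw_same_card)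
    moreover have "card {0, 1 :: 'f} \<le> CARD('f)" by (rule card_mono) auto
    ultimately show "card (carrier (residue_field \<nu>)) > 1" by simp
    show "(h \<circ> cls) ` carrier (valuation_ring \<nu>) = UNIV"
      using bij by (simp add: bij_betw_def surj image_comp)
  next
    fix x y assume xy: "x \<in> carrier (valuation_ring \<nu>)" "y \<in> carrier (valuation_ring \<nu>)"
    show "(h \<circ> cls) (x + y) = (h \<circ> cls) x + (h \<circ> cls) y"
      using ring_hom_add[OF ch xy] ring_hom_add[OF hom, of "cls x" "cls y"] xy surj
      by (auto simp: ops ring_of_type_algebra_def)
    show "(h \<circ> cls) (x * y) = (h \<circ> cls) x * (h \<circ> cls) y"
      using ring_hom_mult[OF ch xy] ring_hom_mult[OF hom, of "cls x" "cls y"] xy surj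
      by (auto simp: ops ring_of_type_algebra_def)
  next
    fix x assume x: "x \<in> carrier (valuation_ring \<nu>)"
    \<comment> \<open>Injectivity of \<open>h\<close> reduces vanishing to the coset of
      \<open>x\<close> being the ideal itself, that is, to membership of \<open>x\<close>.\<close>
    have "(h \<circ> cls) x = 0 \<longleftrightarrow> cls x = \<zero>\<^bsub>residue_field \<nu>\<^esub>"
      using inj_on_eq_iff[OF bij_betw_imp_inj_on[OF bij], of "cls x" "\<zero>\<^bsub>residue_field \<nu>\<^esub>"]
        h0 x surj Q.zero_closed by auto
    also have "\<dots> \<longleftrightarrow> x \<in> max_ideal \<nu>"
      unfolding zero cls_def using I.a_rcos_const I.a_rcos_self[OF x] by metis
    finally show "(h \<circ> cls) x = 0 \<longleftrightarrow> x \<in> max_ideal \<nu>" .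
  qed
  then show ?thesis by blast
qed

text \<open>The quotient bounding \<open>k\<close> is exact: it is the number of points of the
  projective space over the residue field.\<close>

theorem theorem1p22:
  fixes \<nu> :: "'k::field \<Rightarrow> int" and k l :: nat
  assumes "discrete_valuation \<nu>"
    and "residue_field \<nu> \<simeq> (ring_of_type_algebra :: 'f::{field,finite} ring)"
    and "k \<ge> l" and "l \<ge> 2" and "l \<le> CARD('n::finite)"
    and "k \<le> (CARD('f) ^ CARD('n) - 1) div (CARD('f) - 1)"
  shows "Gamma_max \<nu> TYPE('n) k l = Ind_pro TYPE('f) TYPE('n) k l"
proof -
  obtain red :: "'k \<Rightarrow> 'f" where "residue_map \<nu> red" using residue_map_exists assms by blast
  then interpret residue_map \<nu> red .
  show ?thesis unfolding Gamma_max_def Ind_pro_def using assms by (intro max_strongly_orthogonal) simp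
qed

end
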